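(* Let $K\ge 1$, let $\boldsymbol{s}=(s_1,\dots,s_K)$ with $1=s_1\le s_2\le\cdots\le s_K$, and let $\boldsymbol{c}\in\mathbb{R}^K$ with $\boldsymbol{c}^T\boldsymbol{c}=1$. Consider the problem $$(\mathrm{P})\qquad \min_{\tilde{\boldsymbol{x}}\in\mathbb{R}^K}\ \tfrac12\,\tilde{\boldsymbol{x}}^T\operatorname{diag}(\boldsymbol{s})\,\tilde{\boldsymbol{x}}+\boldsymbol{c}^T\tilde{\boldsymbol{x}}\quad\text{s.t. }\tilde{\boldsymbol{x}}^T\tilde{\boldsymbol{x}}=1 .$$ Let $\tilde s_1=1<\tilde s_2<\cdots<\tilde s_J$ be the distinct values among $s_1,\dots,s_K$, let $\mathcal{I}_j=\{k: s_k=\tilde s_j\}$, let $\boldsymbol{c}_j=(c_k)_{k\in\mathcal{I}_j}$, and put $\tilde{\boldsymbol{s}}=(\tilde s_1,\dots,\tilde s_J)$ and $\tilde{\boldsymbol{c}}=(\|\boldsymbol{c}_1\|,\dots,\|\boldsymbol{c}_J\|)$. Let $\boldsymbol{z}=(z_1,\dots,z_J)$ be a minimiser of $$\min_{\boldsymbol{z}\in\mathbb{R}^J}\ \tfrac12\,\boldsymbol{z}^T\operatorname{diag}(\tilde{\boldsymbol{s}})\,\boldsymbol{z}+\tilde{\boldsymbol{c}}^T\boldsymbol{z}\quad\text{s.t. }\boldsymbol{z}^T\boldsymbol{z}=1 .$$ Then any vector $\tilde{\boldsymbol{x}}\in\mathbb{R}^K$ whose sub-vectors $\tilde{\boldsymbol{x}}_{\mathcal{I}_j}=(\tilde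 x_k)_{k\in\mathcal{I}_j}$, $j=1,\dots,J$, are given by $$\tilde{\boldsymbol{x}}_{\mathcal{I}_j}=\frac{z_j}{\|\boldsymbol{c}_j\|}\,\boldsymbol{c}_j\ \text{ if }\boldsymbol{c}_j\neq\boldsymbol{0},\qquad \tilde{\boldsymbol{x}}_{\mathcal{I}_j}\ \text{an arbitrary vector with }\|\tilde{\boldsymbol{x}}_{\mathcal{I}_j}\|^2=z_j^2\ \text{ if }\boldsymbol{c}_j=\boldsymbol{0},$$ is a minimiser of $(\mathrm{P})$.
   Context: $\|\cdot\|$ is the Euclidean norm; "minimiser" means global minimiser; $\operatorname{diag}(\boldsymbol{s})$ is the diagonal matrix with diagonal $\boldsymbol{s}$. *)

theory Defs
  imports Complex_Main "Jordan_Normal_Form.Matrix" "Jordan_Normal_Form.DL_Submatrix"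
begin

definition eucl_norm :: "real vec \<Rightarrow> real" where
  "eucl_norm v = sqrt (v \<bullet> v)"

text \<open>The sub-vector of the entries of \<open>v\<close> with index in \<open>I\<close>, in increasing order of the
  indices (the vector counterpart of \<^const>\<open>submatrix\<close>); indices outside \<open>v\<close> are ignored.\<close>
definition subvec :: "'a vec \<Rightarrow> nat set \<Rightarrow> 'a vec" where
  "subvec v I = vec (card {i. i < dim_vec v \<and> i \<in> I}) (\<lambda>i. v $ pick I i)"

definition quad_obj :: "real vec \<Rightarrow> real vec \<Rightarrow> real vec \<Rightarrow> real" where
  "quad_obj s c x =
     1 / 2 * (x \<bullet> (mat_diag (dim_vec s) (\<lambda>i. s $ i) *\<^sub>v x)) + c \<bullet> x"

definition sphere_minimiser :: "real vec \<Rightarrow> real vec \<Rightarrow> real vec \<Rightarrow> bool" where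
  "sphere_minimiser s c x \<longleftrightarrow>
     is_arg_min (quad_obj s c) (\<lambda>y. y \<in> carrier_vec (dim_vec s) \<and> y \<bullet> y = 1) x"

definition level_indices :: "real vec \<Rightarrow> real \<Rightarrow> nat set" where
  "level_indices s t = {k. k < dim_vec s \<and> s $ k = t}"

end

theory Submission
  imports Defs "HOL-Analysis.L2_Norm"
begin

text \<open>Within a level, that is, a set of indices on which \<open>s\<close> is constant, the quadratic part of the
  objective sees a vector \<open>y\<close> only through the squared norm of its sub-vector (\<open>quad_obj_levels\<close>).
  For a given norm of that sub-vector, Cauchy-Schwarz (\<open>scalar_prod_ge\<close>) says that the linear part
  is smallest when the sub-vector is antiparallel to the one of \<open>c\<close>.

  Hence for every feasible \<open>y\<close> the reduced vector \<open>w\<close> whose entries are minus the norms of the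
  sub-vectors of \<open>y\<close> is feasible for the reduced problem, and its reduced objective is at most that
  of \<open>y\<close> (\<open>quad_obj_reduced_le\<close>).  Conversely, expanding a reduced vector \<open>z\<close> along the directions
  of the sub-vectors of \<open>c\<close> (along any direction where \<open>c\<close> vanishes on the level) loses nothing:
  such an \<open>x\<close> has the same norm and objective as \<open>z\<close> (\<open>quad_obj_lift_eq\<close>), because on each
  level the sub-vector of \<open>x\<close> has squared norm \<open>z\<^sub>j\<^sup>2\<close> and its inner product with the sub-vector
  of \<open>c\<close> is \<open>z\<^sub>j\<close> times the norm of the latter (\<open>aligned_subvector\<close>).  So if \<open>z\<close> is optimal,
  then \<open>obj x = obj z \<le> obj w \<le> obj y\<close>.\<close>

section \<open>Inner products of vectors and sub-vectors\<close>

lemma eucl_norm_sq: "(eucl_norm v)\<^sup>2 = v \<bullet> v"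
  unfolding eucl_norm_def by (simp add: scalar_prod_def sum_nonneg)

lemma eucl_norm_eq_0_iff: "eucl_norm v = 0 \<longleftrightarrow> v = 0\<^sub>v (dim_vec v)"
proof -
  have "eucl_norm v = 0 \<longleftrightarrow> (\<Sum>i\<in>{0..<dim_vec v}. v $ i * v $ i) = 0"
    unfolding eucl_norm_def scalar_prod_def by simp
  also have "\<dots> \<longleftrightarrow> (\<forall>i<dim_vec v. v $ i = 0)"
    by (subst sum_nonneg_eq_0_iff) auto
  also have "\<dots> \<longleftrightarrow> v = 0\<^sub>v (dim_vec v)"
    by (metis eq_vecI index_zero_vec(1,2))
  finally show ?thesis .
qed

lemma scalar_prod_ge:
  assumes "dim_vec u = dim_vec v"
  shows "- (eucl_norm u * eucl_norm v) \<le> u \<bullet> v"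
proof -
  let ?A = "{0..<dim_vec v}"
  have "- (u \<bullet> v) \<le> (\<Sum>i\<in>?A. \<bar>u $ i\<bar> * \<bar>v $ i\<bar>)"
    unfolding scalar_prod_def sum_negf[symmetric]
    by (rule sum_mono) (metis abs_ge_minus_self abs_mult)
  also have "\<dots> \<le> L2_set (($) u) ?A * L2_set (($) v) ?A"
    by (rule L2_set_mult_ineq)
  also have "\<dots> = eucl_norm u * eucl_norm v"
    using assms by (simp add: L2_set_def eucl_norm_def scalar_prod_def power2_eq_square)
  finally show ?thesis by simp
qed

lemma bij_betw_pick:
  assumes "finite S"
  shows "bij_betw (pick S) {..<card S} S"
proof -
  have inj: "inj_on (pick S) {..<card S}"
  proof (rule linorder_inj_onI)
    fix i j assume "i < j" "j \<in> {..<card S}"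
    then show "pick S i \<noteq> pick S j"
      using pick_mono_le[of j S i] by simp
  qed auto
  moreover have "pick S ` {..<card S} \<subseteq> S"
    using pick_in_set_le by auto
  ultimately have "pick S ` {..<card S} = S"
    using assms by (intro card_subset_eq) (simp_all add: card_image)
  with inj show ?thesis by (simp add: bij_betw_def)
qed

lemma dim_subvec:
  assumes "S \<subseteq> {..<dim_vec v}"
  shows "dim_vec (subvec v S) = card S"
proof -
  have "{i. i < dim_vec v \<and> i \<in> S} = S" using assms by auto
  then show ?thesis by (simp add: subvec_def)
qed

lemma scalar_prod_subvec:
  assumes "dim_vec u = n" "dim_vec v = n" "S \<subseteq> {..<n}"
  shows "subvec u S \<bullet> subvec v S = (\<Sum>k\<in>S. u $ k * v $ k)"
proof -
  have S: "{i. i < n \<and> i \<in> S} = S" using assms by auto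
  have "subvec u S \<bullet> subvec v S = (\<Sum>i<card S. u $ pick S i * v $ pick S i)"
    using assms by (simp add: subvec_def scalar_prod_def S atLeast0LessThan)
  also have "\<dots> = (\<Sum>k\<in>S. u $ k * v $ k)"
    using assms(3) by (intro sum.reindex_bij_betw bij_betw_pick) (rule finite_subset, auto)
  finally show ?thesis .
qed

section \<open>Decomposition of the problem into levels\<close>

lemma quad_obj_sum:
  assumes "dim_vec c = dim_vec s" "dim_vec x = dim_vec s"
  shows "quad_obj s c x = (\<Sum>k<dim_vec s. 1 / 2 * (s $ k * (x $ k)\<^sup>2) + c $ k * x $ k)"
proof -
  have "(mat_diag (dim_vec s) (($) s) *\<^sub>v x) $ k = s $ k * x $ k" if "k < dim_vec s" for k
  proof -
    have "(mat_diag (dim_vec s) (($) s) *\<^sub>v x) $ k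
        = (\<Sum>i\<in>{0..<dim_vec s}. (if k = i then s $ i else 0) * x $ i)"
      using that assms by (simp add: mat_diag_def scalar_prod_def)
    also have "\<dots> = (\<Sum>i\<in>{0..<dim_vec s}. if i = k then s $ i * x $ i else 0)"
      by (rule sum.cong) auto
    also have "\<dots> = s $ k * x $ k" using that by simp
    finally show ?thesis .
  qed
  then have "x \<bullet> (mat_diag (dim_vec s) (($) s) *\<^sub>v x) = (\<Sum>k<dim_vec s. s $ k * (x $ k)\<^sup>2)"
    unfolding scalar_prod_def
    by (auto intro!: sum.cong simp: mat_diag_def power2_eq_square)
  then show ?thesis
    using assms
    by (simp add: quad_obj_def scalar_prod_def atLeast0LessThan sum.distrib sum_distrib_left)
qed

text \<open>Here \<open>st\<close> enumerates the values of \<open>s\<close> without repetition, so that the levels of its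
  entries partition the indices of \<open>s\<close>.\<close>

locale distinct_levels =
  fixes s st :: "real vec"
  assumes inj: "inj_on (($) st) {..<dim_vec st}"
    and range: "set\<^sub>v st = set\<^sub>v s"
begin

abbreviation level :: "nat \<Rightarrow> nat set" where
  "level j \<equiv> level_indices s (st $ j)"

abbreviation level_norms :: "real vec \<Rightarrow> real vec" where
  "level_norms v \<equiv> vec (dim_vec st) (\<lambda>j. eucl_norm (subvec v (level j)))"

lemma level_subset: "level j \<subseteq> {..<dim_vec s}"
  by (auto simp: level_indices_def)

lemma sum_levels: "(\<Sum>k<dim_vec s. f k) = (\<Sum>j<dim_vec st. \<Sum>k\<in>level j. f k)"
proof -
  have "(\<Sum>k<dim_vec s. f k) = (\<Sum>t\<in>(($) s) ` {..<dim_vec s}. \<Sum>k | k \<in> {..<dim_vec s} \<and> s $ k = t. f k)"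
    by (rule sum.image_gen) simp
  also have "\<dots> = (\<Sum>t\<in>(($) st) ` {..<dim_vec st}. \<Sum>k\<in>level_indices s t. f k)"
    using range by (simp add: vec_set_def level_indices_def)
  also have "\<dots> = (\<Sum>j<dim_vec st. \<Sum>k\<in>level j. f k)"
    by (simp add: sum.reindex[OF inj])
  finally show ?thesis .
qed

lemma norm_sq_levels:
  assumes "dim_vec y = dim_vec s"
  shows "y \<bullet> y = (\<Sum>j<dim_vec st. (eucl_norm (subvec y (level j)))\<^sup>2)"
proof -
  have "y \<bullet> y = (\<Sum>j<dim_vec st. \<Sum>k\<in>level j. y $ k * y $ k)"
    using assms by (simp add: scalar_prod_def atLeast0LessThan sum_levels)
  then show ?thesis
    using assms by (simp add: eucl_norm_sq scalar_prod_subvec[OF _ _ level_subset])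
qed

lemma quad_obj_levels:
  assumes "dim_vec c = dim_vec s" "dim_vec y = dim_vec s"
  shows "quad_obj s c y = (\<Sum>j<dim_vec st.
    1 / 2 * (st $ j * (eucl_norm (subvec y (level j)))\<^sup>2)
    + subvec c (level j) \<bullet> subvec y (level j))"
proof -
  have "(\<Sum>k\<in>level j. 1 / 2 * (s $ k * (y $ k)\<^sup>2) + c $ k * y $ k)
      = 1 / 2 * (st $ j * (eucl_norm (subvec y (level j)))\<^sup>2)
        + subvec c (level j) \<bullet> subvec y (level j)" for j
  proof -
    have "(\<Sum>k\<in>level j. 1 / 2 * (s $ k * (y $ k)\<^sup>2) + c $ k * y $ k)
        = (\<Sum>k\<in>level j. 1 / 2 * (st $ j * (y $ k * y $ k)) + c $ k * y $ k)"
      by (rule sum.cong) (auto simp: level_indices_def power2_eq_square)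
    then show ?thesis
      using assms
      by (simp add: eucl_norm_sq scalar_prod_subvec[OF _ _ level_subset] sum.distrib
          sum_distrib_left)
  qed
  then show ?thesis
    using assms by (simp add: quad_obj_sum sum_levels)
qed

section \<open>Comparison with the reduced problem\<close>

lemma norm_sq_reduced:
  assumes "dim_vec y = dim_vec s"
  shows "(- level_norms y) \<bullet> (- level_norms y) = y \<bullet> y"
  unfolding norm_sq_levels[OF assms]
  by (simp add: scalar_prod_def atLeast0LessThan power2_eq_square)

text \<open>The quadratic parts agree, since squaring removes the sign.  The minus sign makes the linear
  part of the reduced objective the Cauchy-Schwarz lower bound on each level.\<close>

lemma quad_obj_reduced_le:
  assumes "dim_vec c = dim_vec s" "dim_vec y = dim_vec s"
  shows "quad_obj st (level_norms c) (- level_norms y) \<le> quad_obj s c y"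
  unfolding quad_obj_levels[OF assms]
  using assms
  by (subst quad_obj_sum)
    (auto intro!: sum_mono scalar_prod_ge simp: dim_subvec level_subset)

lemma quad_obj_lift_eq:
  assumes "dim_vec c = dim_vec s" "dim_vec x = dim_vec s" "dim_vec z = dim_vec st"
    and "\<And>j. j < dim_vec st \<Longrightarrow> (eucl_norm (subvec x (level j)))\<^sup>2 = (z $ j)\<^sup>2"
    and "\<And>j. j < dim_vec st \<Longrightarrow>
      subvec c (level j) \<bullet> subvec x (level j) = eucl_norm (subvec c (level j)) * z $ j"
  shows "quad_obj s c x = quad_obj st (level_norms c) z"
  unfolding quad_obj_levels[OF assms(1,2)]
  using assms by (subst quad_obj_sum) auto

end

section \<open>Minimisers of the reduced problem lift to minimisers\<close>

text \<open>The two hypotheses on a sub-vector \<open>x'\<close> of \<open>x\<close>, for \<open>c' \<noteq> 0\<close> and for \<open>c' = 0\<close>, have these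
  common consequences, which are all that optimality depends on.\<close>

lemma aligned_subvector:
  assumes "dim_vec x' = dim_vec c'"
    and "c' \<noteq> 0\<^sub>v (dim_vec c') \<Longrightarrow> x' = (\<zeta> / eucl_norm c') \<cdot>\<^sub>v c'"
    and "c' = 0\<^sub>v (dim_vec c') \<Longrightarrow> (eucl_norm x')\<^sup>2 = \<zeta>\<^sup>2"
  shows "(eucl_norm x')\<^sup>2 = \<zeta>\<^sup>2" and "c' \<bullet> x' = eucl_norm c' * \<zeta>"
proof -
  have "(eucl_norm x')\<^sup>2 = \<zeta>\<^sup>2 \<and> c' \<bullet> x' = eucl_norm c' * \<zeta>"
  proof (cases "c' = 0\<^sub>v (dim_vec c')")
    case True
    have "c' \<bullet> x' = 0"
      using assms(1) by (subst True) (simp add: scalar_prod_def)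
    then show ?thesis using assms(3) True eucl_norm_eq_0_iff[of c'] by simp
  next
    case False
    then have nz: "eucl_norm c' \<noteq> 0" by (simp add: eucl_norm_eq_0_iff)
    have x': "x' = (\<zeta> / eucl_norm c') \<cdot>\<^sub>v c'" using assms(2) False by blast
    have inner: "c' \<bullet> x' = \<zeta> / eucl_norm c' * (eucl_norm c')\<^sup>2"
      unfolding x' by (simp add: eucl_norm_sq)
    have "(eucl_norm x')\<^sup>2 = \<zeta> / eucl_norm c' * (c' \<bullet> x')"
      unfolding eucl_norm_sq by (subst x') (simp add: x')
    with inner nz show ?thesis by (simp add: power2_eq_square)
  qed
  then show "(eucl_norm x')\<^sup>2 = \<zeta>\<^sup>2" and "c' \<bullet> x' = eucl_norm c' * \<zeta>" by auto
qed

theorem lemma1: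
  fixes K J :: nat and s c st ct z x :: "real vec" and I :: "nat \<Rightarrow> nat set"
  assumes "K \<ge> 1"
    and "s \<in> carrier_vec K"
    and "s $ 0 = 1"
    and "\<And>i j. i \<le> j \<Longrightarrow> j < K \<Longrightarrow> s $ i \<le> s $ j"
    and "c \<in> carrier_vec K"
    and "c \<bullet> c = 1"
    and "st \<in> carrier_vec J"
    and "\<And>i j. i < j \<Longrightarrow> j < J \<Longrightarrow> st $ i < st $ j"
    and "set\<^sub>v st = set\<^sub>v s"
    and "I = (\<lambda>j. level_indices s (st $ j))"
    and "ct = vec J (\<lambda>j. eucl_norm (subvec c (I j)))"
    and "sphere_minimiser st ct z"
    and "x \<in> carrier_vec K"
    and "\<And>j. j < J \<Longrightarrow> subvec c (I j) \<noteq> 0\<^sub>v (card (I j)) \<Longrightarrow>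
           subvec x (I j) = (z $ j / eucl_norm (subvec c (I j))) \<cdot>\<^sub>v subvec c (I j)"
    and "\<And>j. j < J \<Longrightarrow> subvec c (I j) = 0\<^sub>v (card (I j)) \<Longrightarrow>
           (eucl_norm (subvec x (I j)))\<^sup>2 = (z $ j)\<^sup>2"
  shows "sphere_minimiser s c x"
proof -
  have dims: "dim_vec s = K" "dim_vec c = K" "dim_vec x = K" "dim_vec st = J"
    using assms by auto
  interpret distinct_levels s st
  proof
    show "inj_on (($) st) {..<dim_vec st}"
    proof (rule linorder_inj_onI)
      fix i j assume "i < j" "j \<in> {..<dim_vec st}"
      then show "st $ i \<noteq> st $ j"
        using assms(8)[of i j] dims by simp
    qed auto
  qed (fact assms(9))
  have I: "I j = level j" for j using assms(10) by simp
  have ct: "ct = level_norms c" using assms(11) dims I by simp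
  have z: "dim_vec z = J" "z \<bullet> z = 1"
    using assms(12) dims unfolding sphere_minimiser_def is_arg_min_def by auto
  have z_min: "quad_obj st ct z \<le> quad_obj st ct w" if "dim_vec w = J" "w \<bullet> w = 1" for w
    using assms(12) that dims carrier_vec_dim_vec[of w]
    unfolding sphere_minimiser_def is_arg_min_def not_less[symmetric] by metis
  have card_I: "dim_vec (subvec c (I j)) = card (I j)" "dim_vec (subvec x (I j)) = card (I j)" for j
    using level_subset[of j] dims by (simp_all add: I dim_subvec)
  have norm_x: "(eucl_norm (subvec x (level j)))\<^sup>2 = (z $ j)\<^sup>2"
    and inner_x: "subvec c (level j) \<bullet> subvec x (level j) = eucl_norm (subvec c (level j)) * z $ j"
    if "j < J" for j
    using aligned_subvector[of "subvec x (I j)" "subvec c (I j)" "z $ j"] that assms(14,15)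
    by (simp_all add: card_I flip: I)
  have "x \<bullet> x = z \<bullet> z"
    using dims z(1) norm_x
    by (simp add: norm_sq_levels scalar_prod_def[of z] atLeast0LessThan power2_eq_square)
  moreover have "quad_obj s c x \<le> quad_obj s c y" if y: "y \<in> carrier_vec K" "y \<bullet> y = 1" for y
  proof -
    have "quad_obj s c x = quad_obj st ct z"
      unfolding ct by (rule quad_obj_lift_eq) (use dims z norm_x inner_x in auto)
    also have "\<dots> \<le> quad_obj st ct (- level_norms y)"
    proof (rule z_min)
      show "(- level_norms y) \<bullet> (- level_norms y) = 1"
        using norm_sq_reduced[of y] y dims(1) by (metis carrier_vecD)
    qed (use dims in simp)
    also have "\<dots> \<le> quad_obj s c y"
      unfolding ct by (rule quad_obj_reduced_le) (use dims y in auto)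
    finally show ?thesis .
  qed
  ultimately show ?thesis
    using z(2) assms(13) dims
    unfolding sphere_minimiser_def is_arg_min_def not_less[symmetric] by metis
qed

end
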